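(* There are infinitely many (pairwise non-isomorphic) finite nonabelian groups $G$ admitting a multiset $A$ of cardinality $|G|$ with elements in $G$ such that: (i) $A$ satisfies the abelianization obstruction; (ii) the elements of $A$ can be ordered with product $1$ in $G$; (iii) $A$ is not quotient-realizable in $G$.
   Context: All multisets are counted with multiplicity; groups are written multiplicatively. Quotient-realizable: a multiset $A$ of cardinality $|G|$ with elements in a finite group $G$ is quotient-realizable in $G$ if there exist bijections $b,c:\{1,\ldots,|G|\}\to G$ such that $A=\{b(i)c(i)^{-1}:1\le i\le |G|\}$ as multisets. Abelianization obstruction: let $\pi:G\to G_{\mathrm{ab}}=G/[G,G]$ be the canonical projection. A multiset $A$ in $G$ satisfies the abelianization obstruction if $\prod_{a\in A}\pi(a)=1$ in $G_{\mathrm{ab}}$, the product being taken with multiplicity (independent of order since $G_{\mathrm{ab}}$ is abelian). *)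

theory Defs
  imports "HOL-Algebra.Algebra" "HOL-Library.Multiset"
begin

definition quotient_realizable :: "('a, 'm) monoid_scheme \<Rightarrow> 'a multiset \<Rightarrow> bool" where
  "quotient_realizable G A \<longleftrightarrow>
     (\<exists>b c. bij_betw b {1..order G} (carrier G) \<and> bij_betw c {1..order G} (carrier G) \<and>
        A = image_mset (\<lambda>i. b i \<otimes>\<^bsub>G\<^esub> inv\<^bsub>G\<^esub> (c i)) (mset_set {1..order G}))"

definition abelianization :: "('a, 'm) monoid_scheme \<Rightarrow> 'a set monoid" where
  "abelianization G = G Mod (derived G (carrier G))"

definition ab_proj :: "('a, 'm) monoid_scheme \<Rightarrow> 'a \<Rightarrow> 'a set" where
  "ab_proj G a = derived G (carrier G) #>\<^bsub>G\<^esub> a"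

text \<open>\<open>finprod\<close> ranges over the distinct elements of \<open>A\<close>; multiplicities enter as exponents.\<close>
definition abelianization_obstruction :: "('a, 'm) monoid_scheme \<Rightarrow> 'a multiset \<Rightarrow> bool" where
  "abelianization_obstruction G A \<longleftrightarrow>
     finprod (abelianization G)
       (\<lambda>a. ab_proj G a [^]\<^bsub>abelianization G\<^esub> count A a) (set_mset A)
     = \<one>\<^bsub>abelianization G\<^esub>"

definition orderable_with_product_one :: "('a, 'm) monoid_scheme \<Rightarrow> 'a multiset \<Rightarrow> bool" where
  "orderable_with_product_one G A \<longleftrightarrow>
     (\<exists>xs. mset xs = A \<and> foldr (\<otimes>\<^bsub>G\<^esub>) xs \<one>\<^bsub>G\<^esub> = \<one>\<^bsub>G\<^esub>)"

end

(* Every finite nonabelian group G admits such a multiset, so the symmetric groups suffice. If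
   A = {b c^-1}, then t^-1 A is realized by t^-1 b and c: quotient-realizability is invariant under
   left translation. The multiset {1^(n-2), x, y} with x \<noteq> 1 can only be realized by a bijection
   that swaps the two points it moves, which forces y x = 1. For noncommuting t and x take
   y = t x^-1 t^-1 \<noteq> x^-1. The translate {t^(n-2), t x, t y} is then not realizable, whereas
   (t x) t^(n-2) (t y) = t x t^n x^-1 t^-1 = 1, since t^n = 1 for n = |G|. *)
theory Submission
  imports Defs
begin

text \<open>Bridges the obstruction, where multiplicities are exponents, and a product over a list,
  to which a homomorphism can be applied. A fixed \<open>S\<close> containing the entries serves the
  whole induction, since an absent element contributes \<open>f a [^] 0\<close>.\<close>

lemma (in comm_monoid) finprod_count_mset:
  assumes "finite S" "f \<in> S \<rightarrow> carrier G" "set xs \<subseteq> S"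
  shows "finprod G (\<lambda>a. f a [^] count (mset xs) a) S = foldr (\<otimes>) (map f xs) \<one>"
  using assms(3)
proof (induction xs)
  case (Cons x xs)
  \<comment> \<open>A new head \<open>x\<close> multiplies the family pointwise by the one that is
    \<open>f x\<close> at \<open>x\<close> and \<open>\<one>\<close> elsewhere.\<close>
  have "finprod G (\<lambda>a. f a [^] count (mset (x # xs)) a) S
      = finprod G (\<lambda>a. (if x = a then f a else \<one>) \<otimes> f a [^] count (mset xs) a) S"
    using assms(2) by (intro finprod_cong') (auto simp: Pi_iff m_comm)
  also have "\<dots> = finprod G (\<lambda>a. if x = a then f a else \<one>) S
      \<otimes> finprod G (\<lambda>a. f a [^] count (mset xs) a) S"
    using assms(2) by (intro finprod_multf) (auto simp: Pi_iff)
  also have "\<dots> = f x \<otimes> foldr (\<otimes>) (map f xs) \<one>"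
    using Cons assms by (subst finprod_singleton) auto
  finally show ?case by simp
qed (simp add: assms)

lemma hom_foldr_mult:
  assumes "group_hom G H h" "set xs \<subseteq> carrier G"
  shows "h (foldr (\<otimes>\<^bsub>G\<^esub>) xs \<one>\<^bsub>G\<^esub>) = foldr (\<otimes>\<^bsub>H\<^esub>) (map h xs) \<one>\<^bsub>H\<^esub>"
proof -
  interpret group_hom G H h by fact
  have "foldr (\<otimes>\<^bsub>G\<^esub>) ys \<one>\<^bsub>G\<^esub> \<in> carrier G" if "set ys \<subseteq> carrier G" for ys
    using that by (induction ys) auto
  with assms(2) show ?thesis by (induction xs) auto
qed

text \<open>The projection is a homomorphism, so it sends an ordered product equal to
  \<open>\<one>\<close> to the identity, and in the commutative quotient the order is immaterial.
  Condition (ii) thus yields condition (i).\<close>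

lemma (in group) orderable_imp_abelianization_obstruction:
  assumes "set_mset A \<subseteq> carrier G" "orderable_with_product_one G A"
  shows "abelianization_obstruction G A"
proof -
  interpret N: normal "derived G (carrier G)" G by (rule derived_self_is_normal)
  interpret Q: comm_group "abelianization G"
    unfolding abelianization_def by (rule derived_quot_is_comm_group)
  have "ab_proj G \<in> hom G (abelianization G)"
    using N.r_coset_hom_Mod unfolding ab_proj_def[abs_def] abelianization_def .
  then interpret h: group_hom G "abelianization G" "ab_proj G"
    by unfold_locales
  from assms obtain xs where xs: "mset xs = A" "foldr (\<otimes>) xs \<one> = \<one>"
    unfolding orderable_with_product_one_def by blast
  then have set_xs: "set xs = set_mset A" by auto
  have "finprod (abelianization G)
      (\<lambda>a. ab_proj G a [^]\<^bsub>abelianization G\<^esub> count (mset xs) a) (set_mset A)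
      = foldr (\<otimes>\<^bsub>abelianization G\<^esub>) (map (ab_proj G) xs) \<one>\<^bsub>abelianization G\<^esub>"
    using assms(1) set_xs by (intro Q.finprod_count_mset) auto
  also have "\<dots> = ab_proj G (foldr (\<otimes>) xs \<one>)"
    using hom_foldr_mult[OF h.group_hom_axioms] assms(1) set_xs by simp
  finally show ?thesis
    unfolding abelianization_obstruction_def by (simp add: xs)
qed

lemma bij_betw_differ_at_two:
  assumes "bij_betw d I S" "bij_betw c I S" "i \<in> I" "j \<in> I"
    and eq: "\<And>k. k \<in> I - {i, j} \<Longrightarrow> d k = c k" and "d i \<noteq> c i"
  shows "d i = c j" and "d j = c i"
proof -
  have inj: "inj_on d I" "inj_on c I" and im: "d ` I = S" "c ` I = S"
    using assms(1,2) by (auto simp: bij_betw_def)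
  have "d i \<in> c ` I" using im assms(3) by auto
  then obtain k where k: "k \<in> I" "d i = c k" by auto
  \<comment> \<open>\<open>k = i\<close> contradicts \<open>d i \<noteq> c i\<close>; any other
    \<open>k\<close> would give \<open>d k = c k = d i\<close>, against injectivity of
    \<open>d\<close>. The index \<open>l\<close> below is found likewise, from injectivity of
    \<open>c\<close>.\<close>
  have "k = j"
    using k eq[of k] inj_onD[OF inj(1) _ assms(3), of k] assms(6) by fastforce
  then show dij: "d i = c j" using k by simp
  have "c i \<in> d ` I" using im assms(3) by auto
  then obtain l where l: "l \<in> I" "d l = c i" by auto
  have "l = j"
    using l eq[of l] inj_onD[OF inj(2) _ l(1) assms(3)] assms(6) by fastforce
  then show "d j = c i" using l by simp
qed

lemma (in group) quotient_realizable_two_exceptions: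
  assumes "t \<in> carrier G" "x \<in> carrier G" "y \<in> carrier G" "x \<noteq> \<one>"
    and "quotient_realizable G (add_mset (t \<otimes> x) (add_mset (t \<otimes> y) (replicate_mset m t)))"
  shows "y \<otimes> x = \<one>"
proof -
  let ?I = "{1..order G}"
  from assms(5) obtain b c
    where b: "bij_betw b ?I (carrier G)" and c: "bij_betw c ?I (carrier G)"
      and A: "image_mset (\<lambda>i. b i \<otimes> inv (c i)) (mset_set ?I)
        = add_mset (t \<otimes> x) (add_mset (t \<otimes> y) (replicate_mset m t))"
    unfolding quotient_realizable_def by metis
  \<comment> \<open>Peeling off one occurrence at a time picks an index for each exceptional
    element, even if \<open>t \<otimes> x = t \<otimes> y\<close> or
    \<open>y = \<one>\<close>.\<close>
  from msed_map_invR[OF A] obtain i M where i: "mset_set ?I = add_mset i M"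
      "b i \<otimes> inv (c i) = t \<otimes> x"
      and M: "image_mset (\<lambda>i. b i \<otimes> inv (c i)) M = add_mset (t \<otimes> y) (replicate_mset m t)"
    by blast
  from msed_map_invR[OF M] obtain j N where j: "M = add_mset j N"
      "b j \<otimes> inv (c j) = t \<otimes> y"
      and N: "image_mset (\<lambda>i. b i \<otimes> inv (c i)) N = replicate_mset m t"
    by blast
  have I: "?I = insert i (insert j (set_mset N))"
    using arg_cong[OF i(1), of set_mset] j(1) by simp
  have rest: "b k \<otimes> inv (c k) = t" if "k \<in> ?I - {i, j}" for k
  proof -
    have "k \<in># N" using that unfolding I by simp
    then have "b k \<otimes> inv (c k) \<in># image_mset (\<lambda>i. b i \<otimes> inv (c i)) N" by simp
    then show ?thesis unfolding N by (meson in_replicate_mset)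
  qed
  have ij: "i \<in> ?I" "j \<in> ?I" unfolding I by auto
  have bc: "b k \<in> carrier G" "c k \<in> carrier G" if "k \<in> ?I" for k
    using that b c bij_betwE by blast+
  define d where "d k = inv t \<otimes> b k" for k
  \<comment> \<open>Used with \<open>z\<close> equal to \<open>x\<close> at \<open>i\<close>,
    \<open>y\<close> at \<open>j\<close> and \<open>\<one>\<close> at all other indices.\<close>
  have d: "d k = z \<otimes> c k" if "k \<in> ?I" "z \<in> carrier G" "b k \<otimes> inv (c k) = t \<otimes> z" for k z
    using that bc[OF that(1)] assms(1) inv_solve_right'[of "t \<otimes> z" "b k" "c k"]
      by (simp add: d_def m_assoc inv_solve_left')
  have "bij_betw ((\<lambda>g. inv t \<otimes> g) \<circ> b) ?I (carrier G)"
    using b assms(1) inj_on_cmult[of "inv t"] surj_const_mult[of "inv t"]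
    by (intro bij_betw_trans) (auto simp: bij_betw_def)
  then have d_bij: "bij_betw d ?I (carrier G)"
    by (simp add: d_def[abs_def] comp_def)
  have di: "d i = x \<otimes> c i" and dj: "d j = y \<otimes> c j"
    using d i j ij assms by auto
  have dk: "d k = c k" if "k \<in> ?I - {i, j}" for k
    using that d[of k \<one>] rest[OF that] bc[of k] assms(1) by simp
  have "d i \<noteq> c i"
    using di ij bc assms r_cancel_one[of "c i" x] by simp
  from bij_betw_differ_at_two[OF d_bij c ij dk this]
  \<comment> \<open>The swap \<open>d i = c j\<close>, \<open>d j = c i\<close>, rewritten by
    \<open>di\<close> and \<open>dj\<close>; composing the two equations,
    \<open>y \<otimes> x\<close> fixes \<open>c i\<close>.\<close>
  have "x \<otimes> c i = c j" "y \<otimes> c j = c i"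
    using di dj by auto
  then have "(y \<otimes> x) \<otimes> c i = c i"
    using ij bc assms by (simp add: m_assoc)
  then show ?thesis
    using ij bc assms r_cancel_one[of "c i" "y \<otimes> x"] by simp
qed

lemma (in group) foldr_mult_replicate:
  assumes "t \<in> carrier G" "g \<in> carrier G"
  shows "foldr (\<otimes>) (replicate k t) g = t [^] k \<otimes> g"
proof (induction k)
  case (Suc k)
  have "t \<otimes> (t [^] k \<otimes> g) = t [^] Suc k \<otimes> g"
    using assms by (simp only: nat_pow_Suc2 m_assoc nat_pow_closed)
  with Suc show ?case by simp
qed (simp add: assms)

lemma (in group) nonabelian_orderable_not_quotient_realizable:
  assumes "finite (carrier G)" "\<not> comm_group G"
  obtains A where "size A = order G" "set_mset A \<subseteq> carrier G"
    "orderable_with_product_one G A" "\<not> quotient_realizable G A"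
proof -
  from assms(2) obtain t x
    where t: "t \<in> carrier G" and x: "x \<in> carrier G" and ne: "t \<otimes> x \<noteq> x \<otimes> t"
    using group_comm_groupI by blast
  define y where "y = t \<otimes> inv x \<otimes> inv t"
  have y: "y \<in> carrier G" using t x by (simp add: y_def)
  have x1: "x \<noteq> \<one>" using ne t by auto
  \<comment> \<open>Two distinct elements leave room for both exceptional entries, with
    \<open>m\<close> = |G| - 2 copies of \<open>t\<close> besides.\<close>
  have "card {x, \<one>} \<le> card (carrier G)"
    using x assms(1) by (intro card_mono) auto
  then have "order G \<ge> 2" using x1 by (simp add: order_def)
  then obtain m where m: "order G = Suc (Suc m)"
    by (metis add_2_eq_Suc le_Suc_ex)
  define A where "A = add_mset (t \<otimes> x) (add_mset (t \<otimes> y) (replicate_mset m t))"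
  have "t [^] m \<otimes> (t \<otimes> t) = \<one>"
    using pow_order_eq_1[OF t] t by (simp add: m m_assoc)
  then have "t [^] m \<otimes> (t \<otimes> y) = inv x \<otimes> inv t"
    using t x m_assoc[of "t [^] m" "t \<otimes> t" "inv x \<otimes> inv t", symmetric]
    by (simp add: y_def m_assoc)
  then have "(t \<otimes> x) \<otimes> (t [^] m \<otimes> (t \<otimes> y)) = \<one>"
    using t x by (simp add: inv_mult_group[symmetric])
  \<comment> \<open>The copies of \<open>t\<close> sit just before \<open>t \<otimes> y\<close>,
    whose two leading factors \<open>t\<close> complete them to the power |G|.\<close>
  then have "foldr (\<otimes>) ((t \<otimes> x) # replicate m t @ [t \<otimes> y]) \<one> = \<one>"
    using t x y by (simp add: foldr_mult_replicate del: foldr_replicate)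
  moreover have "mset ((t \<otimes> x) # replicate m t @ [t \<otimes> y]) = A"
    by (simp add: A_def)
  ultimately have "orderable_with_product_one G A"
    unfolding orderable_with_product_one_def by blast
  moreover have "\<not> quotient_realizable G A"
  proof
    assume "quotient_realizable G A"
    then have "y \<otimes> x = \<one>"
      unfolding A_def using quotient_realizable_two_exceptions[OF t x y x1] by blast
    then have "y = inv x" using x y by (metis inv_equality inv_inv)
    then have "t \<otimes> inv x = inv x \<otimes> t"
      using t x inv_solve_right'[of "inv x" "t \<otimes> inv x" t] by (simp add: y_def)
    \<comment> \<open>The two sides reduce to \<open>x \<otimes> t\<close> and
      \<open>t \<otimes> x\<close>.\<close>
    then have "x \<otimes> (t \<otimes> inv x) \<otimes> x = x \<otimes> (inv x \<otimes> t) \<otimes> x" by simp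
    then show False using ne t x by (simp add: m_assoc inv_solve_left)
  qed
  moreover have "size A = order G" "set_mset A \<subseteq> carrier G"
    using t x y by (auto simp: A_def m)
  ultimately show thesis using that by blast
qed

lemma sym_group_not_comm:
  assumes "n \<ge> 3"
  shows "\<not> comm_group (sym_group n)"
proof
  assume "comm_group (sym_group n)"
  then interpret comm_group "sym_group n" .
  have "transpose 1 2 \<in> carrier (sym_group n)" "transpose 2 3 \<in> carrier (sym_group n)"
    using assms by (auto simp: sym_group_carrier intro!: permutes_swap_id)
  then have "transpose 1 2 \<circ> transpose 2 3 = transpose 2 3 \<circ> transpose 1 (2 :: nat)"
    using m_comm by (simp add: sym_group_mult)
  \<comment> \<open>The left side is 2 and the right side is 3.\<close>
  then have "(transpose 1 2 \<circ> transpose 2 3) 1 = (transpose 2 3 \<circ> transpose 1 (2 :: nat)) 1"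
    by simp
  then show False by (simp add: transpose_def)
qed

text \<open>Transports the multiplication along an injection into the naturals. The symmetric groups
  consist of functions, whereas the family sought consists of groups on naturals.\<close>

lemma (in group) finite_group_iso_nat:
  assumes "finite (carrier G)"
  obtains H :: "nat monoid" where "group H" "G \<cong> H"
proof -
  from assms obtain f :: "'a \<Rightarrow> nat" where f: "inj_on f (carrier G)"
    using finite_imp_inj_to_nat_seg by blast
  \<comment> \<open>Injectivity says that \<open>f\<close> identifies two elements exactly when
    their quotient lies in the trivial subgroup.\<close>
  have "weak_group_morphism f {\<one>} G"
    using f one_is_normal
    by (intro weak_group_morphismsI) (auto simp: inj_on_eq_iff inv_solve_right')
  then have "group (image_group f G)" "f \<in> hom G (image_group f G)"
    by (auto intro: image_group_is_group weak_group_morphism_is_hom)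
  moreover from this f have "f \<in> iso G (image_group f G)"
    by (auto simp: iso_def bij_betw_def image_group_carrier)
  ultimately show thesis using that is_isoI by blast
qed

theorem corollary6p3:
  "\<exists>\<G> :: nat monoid set.
     infinite \<G> \<and>
     pairwise (\<lambda>G H. \<not> G \<cong> H) \<G> \<and>
     (\<forall>G\<in>\<G>. group G \<and> finite (carrier G) \<and> \<not> comm_group G \<and>
        (\<exists>A. size A = order G \<and> set_mset A \<subseteq> carrier G \<and>
             abelianization_obstruction G A \<and>
             orderable_with_product_one G A \<and>
             \<not> quotient_realizable G A))"
proof -
  \<comment> \<open>An infinite set has \<open>card\<close> equal to 0, while \<open>fact n\<close>
    is positive.\<close>
  have fin: "finite (carrier (sym_group n))" for n
    using sym_group_card_carrier[of n] card.infinite by fastforce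
  have "\<exists>H :: nat monoid. group H \<and> sym_group n \<cong> H" for n
    using group.finite_group_iso_nat[OF sym_group_is_group fin] by metis
  then obtain H :: "nat \<Rightarrow> nat monoid"
    where H: "\<And>n. group (H n)" "\<And>n. sym_group n \<cong> H n" by metis
  have card_H: "card (carrier (H n)) = fact n" for n
    using iso_same_card[OF H(2)] sym_group_card_carrier by simp
  \<comment> \<open>Isomorphic groups have equal cardinality, but the factorial is strictly
    increasing on positive arguments.\<close>
  have not_iso: "\<not> H m \<cong> H n" if "m \<ge> 3" "n \<ge> 3" "m \<noteq> n" for m n
    using that iso_same_card[of "H m" "H n"] fact_less_mono[of m n, where 'a = nat]
      fact_less_mono[of n m, where 'a = nat]
    by (auto simp: card_H neq_iff)
  \<comment> \<open>Equal groups are isomorphic, so \<open>not_iso\<close> also makes the family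
    infinite.\<close>
  have "inj_on H {3..}"
    using not_iso iso_refl by (metis inj_onI atLeast_iff)
  then have "infinite (H ` {3..})"
    using finite_imageD infinite_Ici by blast
  moreover have "pairwise (\<lambda>G H. \<not> G \<cong> H) (H ` {3..})"
    using not_iso by (auto simp: pairwise_def)
  moreover have "group (H n) \<and> finite (carrier (H n)) \<and> \<not> comm_group (H n) \<and>
      (\<exists>A. size A = order (H n) \<and> set_mset A \<subseteq> carrier (H n) \<and>
        abelianization_obstruction (H n) A \<and> orderable_with_product_one (H n) A \<and>
        \<not> quotient_realizable (H n) A)" if n: "n \<ge> 3" for n
  proof -
    interpret group "H n" by (rule H)
    have fin_H: "finite (carrier (H n))"
      using card_H[of n] card.infinite by fastforce
    have "H n \<cong> sym_group n"
      using H(2) sym_group_is_group group.iso_sym by blast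
    then have nc: "\<not> comm_group (H n)"
      using comm_group.iso_imp_comm_group[of "H n" "sym_group n"] sym_group_not_comm[OF n]
        sym_group_is_group group.is_monoid by blast
    from nonabelian_orderable_not_quotient_realizable[OF fin_H nc] show ?thesis
      using fin_H nc is_group orderable_imp_abelianization_obstruction by metis
  qed
  ultimately show ?thesis
    by (intro exI[of _ "H ` {3..}"]) simp
qed

end
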